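(* Let $n$ and $k$ be nonnegative integers. Define: (1) $V(n,k)$: the number of pairs $(\alpha,\beta)$ of partitions into distinct parts such that $|\alpha|+|\beta|=n$, $\ell(\beta)=k$ and $\max(\beta)\le\ell(\alpha)$. (2) $A(n,k)$: the number of partitions $\lambda=(\lambda_1,\dots,\lambda_\ell)$ of $n$ into distinct parts, together with a choice of which parts are labeled as $x$, such that if $\lambda_i$ is labeled as $x$ then $\lambda_i-\lambda_{i+1}\ge 2$ (with the convention $\lambda_{\ell+1}=0$, so that a part equal to $1$ is never labeled as $x$), and such that exactly $k$ parts are labeled as $x$. (3) $A_{-1}(n,k)$: the number of signed partitions $\sigma=(\pi,\nu)$ of $n$ such that the positive parts differ pairwise by at least $2$ and the smallest positive part is at least $2$, the negative parts are distinct and at most $\ell^+(\sigma)$, and $\ell^+(\sigma)-\ell^-(\sigma)=k$. Then $$V(n,k)=A(n,k)=A_{-1}(n,k).$$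
   Context: A partition $\lambda$ of a nonnegative integer $n$ is a nonincreasing finite sequence $(\lambda_1,\lambda_2,\dots,\lambda_\ell)$ of positive integers (its parts) with sum $|\lambda|=n$; $\ell(\lambda)$ is the number of parts and $\max(\lambda)$ is the largest part (taken to be $0$ for the empty partition). The empty partition is the unique partition of $0$ and is allowed everywhere. A signed partition $\sigma$ of $n$ is a pair $(\pi,\nu)$ of (possibly empty) partitions with $|\pi|-|\nu|=n$. The parts of $\pi$ are the positive parts and the parts of $\nu$ are the negative parts of $\sigma$; $\ell^+(\sigma)=\ell(\pi)$ and $\ell^-(\sigma)=\ell(\nu)$. *)

theory Defs
  imports Main
begin

definition is_partition :: "nat list \<Rightarrow> bool" where
  "is_partition l \<longleftrightarrow> sorted_wrt (\<ge>) l \<and> (\<forall>x\<in>set l. 0 < x)"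

definition partition_of :: "nat list \<Rightarrow> nat \<Rightarrow> bool" where
  "partition_of l n \<longleftrightarrow> is_partition l \<and> sum_list l = n"

definition max_part :: "nat list \<Rightarrow> nat" where
  "max_part l = (if l = [] then 0 else Max (set l))"

text \<open>Positions are counted from 0, so \<open>part l i\<close> is the (i+1)-st part; all positions after
  the last part carry the value 0.\<close>

definition part :: "nat list \<Rightarrow> nat \<Rightarrow> nat" where
  "part l i = (if i < length l then l ! i else 0)"

definition signed_partition_of :: "nat list \<times> nat list \<Rightarrow> int \<Rightarrow> bool" where
  "signed_partition_of \<sigma> n \<longleftrightarrow>
     is_partition (fst \<sigma>) \<and> is_partition (snd \<sigma>) \<and>
     int (sum_list (fst \<sigma>)) - int (sum_list (snd \<sigma>)) = n"

definition V_set :: "nat \<Rightarrow> nat \<Rightarrow> (nat list \<times> nat list) set" where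
  "V_set n k = {(\<alpha>, \<beta>).
     is_partition \<alpha> \<and> distinct \<alpha> \<and> is_partition \<beta> \<and> distinct \<beta> \<and>
     sum_list \<alpha> + sum_list \<beta> = n \<and> length \<beta> = k \<and> max_part \<beta> \<le> length \<alpha>}"

text \<open>The labelling is given by the set \<open>X\<close> of positions of the parts labelled as x.\<close>

definition A_set :: "nat \<Rightarrow> nat \<Rightarrow> (nat list \<times> nat set) set" where
  "A_set n k = {(l, X).
     partition_of l n \<and> distinct l \<and> X \<subseteq> {..<length l} \<and>
     (\<forall>i\<in>X. int (part l i) - int (part l (i + 1)) \<ge> 2) \<and> card X = k}"

text \<open>As \<open>sorted_wrt\<close> compares all pairs of entries, the condition on \<open>\<pi>\<close> is the pairwise one.\<close>

definition A_minus1_set :: "nat \<Rightarrow> nat \<Rightarrow> (nat list \<times> nat list) set" where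
  "A_minus1_set n k = {(\<pi>, \<nu>).
     signed_partition_of (\<pi>, \<nu>) (int n) \<and>
     sorted_wrt (\<lambda>x y. x \<ge> y + 2) \<pi> \<and> (\<forall>x\<in>set \<pi>. 2 \<le> x) \<and>
     distinct \<nu> \<and> (\<forall>y\<in>set \<nu>. y \<le> length \<pi>) \<and>
     int (length \<pi>) - int (length \<nu>) = int k}"

definition V_count :: "nat \<Rightarrow> nat \<Rightarrow> nat" where
  "V_count n k = card (V_set n k)"

definition A_count :: "nat \<Rightarrow> nat \<Rightarrow> nat" where
  "A_count n k = card (A_set n k)"

definition A_minus1_count :: "nat \<Rightarrow> nat \<Rightarrow> nat" where
  "A_minus1_count n k = card (A_minus1_set n k)"

text \<open>All three sets are finite, so the cardinalities above are genuine counts and not the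
  default value 0 of \<open>card\<close>.\<close>

lemma length_le_sum_list_pos:
  fixes l :: "nat list"
  shows "\<forall>x\<in>set l. 0 < x \<Longrightarrow> length l \<le> sum_list l"
  by (induction l) auto

lemma finite_partitions_le: "finite {l. is_partition l \<and> sum_list l \<le> m}"
proof (rule finite_subset)
  show "{l. is_partition l \<and> sum_list l \<le> m} \<subseteq> {l. set l \<subseteq> {..m} \<and> length l \<le> m}"
    by (auto simp: is_partition_def intro: order_trans[OF member_le_sum_list]
        order_trans[OF length_le_sum_list_pos])
  show "finite {l. set l \<subseteq> {..m} \<and> length l \<le> m}"
    by (rule finite_lists_length_le) simp
qed

lemma finite_V_set: "finite (V_set n k)"
  by (rule finite_subset[OF _ finite_cartesian_product[OF finite_partitions_le[of n]
        finite_partitions_le[of n]]]) (auto simp: V_set_def)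

lemma finite_A_set: "finite (A_set n k)"
proof (rule finite_subset)
  show "A_set n k \<subseteq> {l. is_partition l \<and> sum_list l \<le> n} \<times> Pow {..<n}"
  proof (clarify, intro conjI SigmaI)
    fix l X assume "(l, X) \<in> A_set n k"
    then have l: "is_partition l" "sum_list l = n" and X: "X \<subseteq> {..<length l}"
      by (auto simp: A_set_def partition_of_def)
    show "l \<in> {l. is_partition l \<and> sum_list l \<le> n}" using l by simp
    have "length l \<le> n" using l length_le_sum_list_pos[of l] by (simp add: is_partition_def)
    then show "X \<in> Pow {..<n}" using X by auto
  qed
qed (simp add: finite_partitions_le)

lemma sum_list_gap2_ge:
  fixes l :: "nat list"
  assumes "sorted_wrt (\<lambda>x y. x \<ge> y + 2) l" "\<forall>x\<in>set l. 2 \<le> x"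
  shows "length l * (length l + 1) \<le> sum_list l \<and> (l \<noteq> [] \<longrightarrow> 2 * length l \<le> hd l)"
  using assms
proof (induction l)
  case (Cons a l)
  then have IH: "length l * (length l + 1) \<le> sum_list l" "l \<noteq> [] \<longrightarrow> 2 * length l \<le> hd l"
    by auto
  have "2 * length (a # l) \<le> a"
    using Cons.prems IH(2) by (cases l) auto
  then show ?case using IH(1) by simp
qed simp

lemma finite_A_minus1_set: "finite (A_minus1_set n k)"
proof (rule finite_subset)
  let ?P = "\<lambda>m. {l. is_partition l \<and> sum_list l \<le> m}"
  show "A_minus1_set n k \<subseteq> ?P (2 * n) \<times> ?P n"
  proof (clarify)
    fix \<pi> \<nu> assume *: "(\<pi>, \<nu>) \<in> A_minus1_set n k"
    let ?l = "length \<pi>"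
    have pi: "?l * (?l + 1) \<le> sum_list \<pi>"
      using * sum_list_gap2_ge[of \<pi>] by (auto simp: A_minus1_set_def)
    have "sum_list \<nu> = \<Sum>(set \<nu>)"
      using * sum_list_distinct_conv_sum_set[of \<nu> "\<lambda>x. x"] by (auto simp: A_minus1_set_def)
    also have "\<dots> \<le> \<Sum>{0..?l}"
      using * by (intro sum_mono2) (auto simp: A_minus1_set_def)
    also have "\<dots> = ?l * (?l + 1) div 2"
      by (simp add: gauss_sum_nat)
    finally have nu: "2 * sum_list \<nu> \<le> ?l * (?l + 1)" by simp
    have "sum_list \<pi> = n + sum_list \<nu>" "is_partition \<pi>" "is_partition \<nu>"
      using * by (auto simp: A_minus1_set_def signed_partition_of_def)
    with pi nu show "\<pi> \<in> ?P (2 * n) \<and> \<nu> \<in> ?P n" by simp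
  qed
qed (simp add: finite_partitions_le)

end

theory Submission
  imports Defs
begin

text \<open>Adding 1 to the first i + 1 parts of a partition raises the gap after the part at position
  i by 1 and leaves the other gaps unchanged. Doing so for each part i + 1 of \<open>\<beta>\<close> turns
  a partition \<open>\<alpha>\<close> with gaps at least 1 into one whose gaps at the labelled positions
  are at least 2; this matches V with A. Doing so in turn for the unlabelled positions makes all
  gaps at least 2, and the added total is the size of \<open>\<nu>\<close>; this matches A
  with the signed partitions.\<close>

section \<open>Partitions described by their gaps\<close>

text \<open>The lower bound may vary with the position, so that labelled and unlabelled parts fit
  one predicate. Since \<open>part\<close> is 0 past the end, the bound at the last position is a
  lower bound on the smallest part.\<close>

definition has_gaps :: "(nat \<Rightarrow> nat) \<Rightarrow> nat list \<Rightarrow> bool" where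
  "has_gaps d l \<longleftrightarrow> (\<forall>i<length l. part l (Suc i) + d i \<le> part l i)"

lemma part_Cons_0 [simp]: "part (a # l) 0 = a"
  by (simp add: part_def)

lemma part_Cons_Suc [simp]: "part (a # l) (Suc i) = part l i"
  by (simp add: part_def)

lemma has_gaps_Cons:
  "has_gaps d (a # l) \<longleftrightarrow> part l 0 + d 0 \<le> a \<and> has_gaps (\<lambda>i. d (Suc i)) l"
  by (auto simp: has_gaps_def All_less_Suc2)

lemma has_gaps_mono: "has_gaps d l \<Longrightarrow> (\<And>i. i < length l \<Longrightarrow> d' i \<le> d i) \<Longrightarrow> has_gaps d' l"
  unfolding has_gaps_def by (meson add_left_mono order_trans)

lemma has_gaps_le_first: "has_gaps d l \<Longrightarrow> x \<in> set l \<Longrightarrow> x \<le> part l 0"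
proof (induction l arbitrary: d)
  case (Cons a l)
  then show ?case by (fastforce simp: has_gaps_Cons)
qed simp

lemma has_gaps_const_iff:
  "has_gaps (\<lambda>i. d) l \<longleftrightarrow> sorted_wrt (\<lambda>x y. y + d \<le> x) l \<and> (\<forall>x\<in>set l. d \<le> x)"
proof (induction l)
  case Nil
  then show ?case by (simp add: has_gaps_def)
next
  case (Cons a l)
  \<comment> \<open>The first entry of \<open>l\<close> is its largest, so bounding it bounds all
    the others; for empty \<open>l\<close> the default value 0 leaves just
    \<open>d \<le> a\<close>.\<close>
  have "part l 0 + d \<le> a \<longleftrightarrow> (\<forall>x\<in>set l. x + d \<le> a) \<and> d \<le> a" if "has_gaps (\<lambda>i. d) l"
    using has_gaps_le_first[OF that] by (cases l) (force simp: part_def)+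
  then show ?case using Cons by (auto simp: has_gaps_Cons)
qed

text \<open>Between naturals a gap of at least 1 is strict descent, and the gap from the last part
  down to 0 gives positivity.\<close>

lemma distinct_partition_iff_has_gaps:
  "is_partition l \<and> distinct l \<longleftrightarrow> has_gaps (\<lambda>i. 1) l"
proof -
  have "sorted_wrt (\<lambda>x y. y + 1 \<le> x) l \<longleftrightarrow> sorted_wrt (\<ge>) l \<and> distinct l"
    by (induction l) (auto simp: Suc_le_eq order.strict_iff_order)
  then show ?thesis by (auto simp: has_gaps_const_iff is_partition_def)
qed

section \<open>Raising gaps at a set of positions\<close>

text \<open>All increments at once: each x in \<open>X\<close> adds 1 to the positions 0 to x, so
  position i receives one unit for every element of \<open>X\<close> that is at least i.\<close>

definition raise :: "nat list \<Rightarrow> nat set \<Rightarrow> nat list" where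
  "raise l X = map (\<lambda>i. l ! i + card (X \<inter> {i..})) [0..<length l]"

lemma length_raise [simp]: "length (raise l X) = length l"
  by (simp add: raise_def)

lemma part_raise:
  assumes "X \<subseteq> {..<length l}"
  shows "part (raise l X) i = part l i + card (X \<inter> {i..})"
proof (cases "i < length l")
  case False
  then have "X \<inter> {i..} = {}" using assms by auto
  then show ?thesis using False by (simp add: part_def)
qed (simp add: part_def raise_def)

lemma card_Int_atLeast_Suc:
  fixes X :: "nat set"
  assumes "finite X"
  shows "card (X \<inter> {i..}) = card (X \<inter> {Suc i..}) + of_bool (i \<in> X)"
proof -
  have "X \<inter> {i..} = (if i \<in> X then insert i (X \<inter> {Suc i..}) else X \<inter> {Suc i..})"
    by (auto simp: Suc_le_eq order.order_iff_strict)
  then show ?thesis using assms by simp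
qed

text \<open>From position i to its successor the added amount \<open>card (X \<inter> {i..})\<close>
  drops by 1 if i lies in \<open>X\<close> and stays the same otherwise, so exactly the gaps at
  \<open>X\<close> grow, each by 1.\<close>

lemma has_gaps_raise_iff:
  assumes "X \<subseteq> {..<length l}"
  shows "has_gaps (\<lambda>i. d i + of_bool (i \<in> X)) (raise l X) \<longleftrightarrow> has_gaps d l"
proof -
  have "finite X" using assms finite_subset by blast
  then have "part (raise l X) (Suc i) + (d i + of_bool (i \<in> X)) \<le> part (raise l X) i \<longleftrightarrow>
      part l (Suc i) + d i \<le> part l i" for i
    using card_Int_atLeast_Suc[of X i] by (simp add: part_raise[OF assms])
  then show ?thesis by (simp add: has_gaps_def)
qed

lemma raise_inject:
  assumes "raise l X = raise l' X"
  shows "l = l'"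
proof (rule nth_equalityI)
  show len: "length l = length l'"
    using arg_cong[OF assms, of length] by simp
  fix i assume "i < length l"
  then show "l ! i = l' ! i"
    using arg_cong[OF assms, of "\<lambda>m. m ! i"] len unfolding raise_def by simp
qed

text \<open>Double counting: the element x of \<open>X\<close> contributes 1 to each of the
  \<open>Suc x\<close> positions up to x.\<close>

lemma sum_list_raise:
  assumes "X \<subseteq> {..<length l}"
  shows "sum_list (raise l X) = sum_list l + sum Suc X"
proof -
  have fin: "finite X" using assms finite_subset by blast
  have "(\<Sum>i<length l. card (X \<inter> {i..})) = (\<Sum>i<length l. \<Sum>x\<in>X. of_bool (i \<le> x))"
    using fin by (simp add: Int_def)
  also have "\<dots> = (\<Sum>x\<in>X. \<Sum>i<length l. of_bool (i \<le> x))"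
    by (rule sum.swap)
  also have "\<dots> = sum Suc X"
  proof (rule sum.cong)
    fix x assume "x \<in> X"
    then have "{..<length l} \<inter> {i. i \<le> x} = {..x}" using assms by auto
    then show "(\<Sum>i<length l. of_bool (i \<le> x)) = Suc x" by simp
  qed simp
  finally show ?thesis
    by (simp add: raise_def interv_sum_list_conv_sum_set_nat sum_list_sum_nth sum.distrib
        atLeast0LessThan)
qed

lemma raise_surj:
  assumes X: "X \<subseteq> {..<length m}" and gaps: "has_gaps (\<lambda>i. d i + of_bool (i \<in> X)) m"
  obtains l where "length l = length m" "raise l X = m" "has_gaps d l"
proof
  have fin: "finite X" using X finite_subset by blast
  \<comment> \<open>This keeps the subtraction in \<open>l\<close> below from truncating. The
    induction descends from the end of the list, where both sides are 0; each step down to i adds at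
    least \<open>of_bool (i \<in> X)\<close> to the part.\<close>
  have le: "card (X \<inter> {i..}) \<le> part m i" if "i \<le> length m" for i
    using that
  proof (induction rule: inc_induct)
    case base
    have "X \<inter> {length m..} = {}" using X by auto
    then show ?case by simp
  next
    case (step i)
    then have "part m (Suc i) + (d i + of_bool (i \<in> X)) \<le> part m i"
      using gaps by (simp add: has_gaps_def)
    then show ?case using step.IH card_Int_atLeast_Suc[OF fin, of i] by linarith
  qed
  define l where "l = map (\<lambda>i. m ! i - card (X \<inter> {i..})) [0..<length m]"
  show len: "length l = length m" by (simp add: l_def)
  show raise: "raise l X = m"
  proof (rule nth_equalityI)
    fix i assume "i < length (raise l X)"
    then have "i < length m" by (simp add: len)
    with le[of i] show "raise l X ! i = m ! i"
      by (simp add: raise_def l_def part_def)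
  qed (simp add: len)
  show "has_gaps d l"
    using has_gaps_raise_iff[of X l d] X len gaps raise by simp
qed

section \<open>Distinct partitions as sets of positions\<close>

text \<open>The part b is encoded by the position b - 1.\<close>

definition parts_list :: "nat set \<Rightarrow> nat list" where
  "parts_list X = rev (sorted_list_of_set (Suc ` X))"

definition positions :: "nat list \<Rightarrow> nat set" where
  "positions l = {i. Suc i \<in> set l}"

lemma parts_list_props:
  assumes "finite X"
  shows "is_partition (parts_list X)" "distinct (parts_list X)" "set (parts_list X) = Suc ` X"
    "length (parts_list X) = card X" "sum_list (parts_list X) = sum Suc X"
    "positions (parts_list X) = X"
proof -
  show "distinct (parts_list X)" "set (parts_list X) = Suc ` X"
    "length (parts_list X) = card X"
    using assms by (auto simp: parts_list_def card_image)
  show "sum_list (parts_list X) = sum Suc X"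
    using assms by (simp add: parts_list_def sum_list_rev distinct_sum_list_conv_Sum sum.reindex)
  show "is_partition (parts_list X)" "positions (parts_list X) = X"
    using assms by (auto simp: parts_list_def is_partition_def positions_def sorted_wrt_rev)
qed

lemma Suc_image_positions: "is_partition l \<Longrightarrow> Suc ` positions l = set l"
  by (force simp: positions_def is_partition_def image_iff gr0_conv_Suc)

lemma finite_positions [simp]: "finite (positions l)"
proof -
  have "positions l = Suc -` set l" by (auto simp: positions_def)
  then show ?thesis by (simp add: finite_vimageI)
qed

lemma parts_list_positions:
  assumes "is_partition l" "distinct l"
  shows "parts_list (positions l) = l"
proof -
  have "sorted_list_of_set (set (rev l)) = rev l"
    using assms by (intro sorted_list_of_set.idem_if_sorted_distinct)
      (auto simp: is_partition_def sorted_wrt_rev)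
  then show ?thesis using assms(1) by (simp add: parts_list_def Suc_image_positions)
qed

text \<open>A part y is at most \<open>m\<close> exactly if its position y - 1 is below
  \<open>m\<close>. This turns the bounds on the parts of \<beta> and \<nu> into the hypothesis
  under which \<open>raise\<close> behaves well.\<close>

lemma positions_subset_iff:
  assumes "is_partition l"
  shows "positions l \<subseteq> {..<m} \<longleftrightarrow> (\<forall>y\<in>set l. y \<le> m)"
  using Suc_image_positions[OF assms, symmetric] by (auto simp: Suc_le_eq)

lemma max_part_le_iff: "max_part l \<le> m \<longleftrightarrow> (\<forall>y\<in>set l. y \<le> m)"
  by (simp add: max_part_def)

section \<open>The three families in terms of gaps\<close>

lemma V_set_iff:
  "(\<alpha>, \<beta>) \<in> V_set n k \<longleftrightarrow> has_gaps (\<lambda>i. 1) \<alpha> \<and> is_partition \<beta> \<and> distinct \<beta> \<and>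
     sum_list \<alpha> + sum_list \<beta> = n \<and> length \<beta> = k \<and> positions \<beta> \<subseteq> {..<length \<alpha>}"
  using distinct_partition_iff_has_gaps[of \<alpha>] positions_subset_iff[of \<beta> "length \<alpha>"]
  by (simp add: V_set_def max_part_le_iff) blast

text \<open>Distinctness asks for a gap of 1 everywhere and a label for one more unit, so both
  conditions merge into a single bound per position.\<close>

lemma A_set_iff:
  "(l, X) \<in> A_set n k \<longleftrightarrow> X \<subseteq> {..<length l} \<and>
     has_gaps (\<lambda>i. 1 + of_bool (i \<in> X)) l \<and> sum_list l = n \<and> card X = k"
proof -
  have "has_gaps (\<lambda>i. 1 + of_bool (i \<in> X)) l \<longleftrightarrow>
      has_gaps (\<lambda>i. 1) l \<and> (\<forall>i\<in>X. int (part l i) - int (part l (i + 1)) \<ge> 2)"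
    if "X \<subseteq> {..<length l}"
  proof
    assume gaps: "has_gaps (\<lambda>i. 1 + of_bool (i \<in> X)) l"
    have "part l (Suc i) + 2 \<le> part l i" if "i \<in> X" for i
      using gaps \<open>X \<subseteq> {..<length l}\<close> that by (force simp: has_gaps_def)
    then show "has_gaps (\<lambda>i. 1) l \<and> (\<forall>i\<in>X. int (part l i) - int (part l (i + 1)) \<ge> 2)"
      using has_gaps_mono[OF gaps, of "\<lambda>i. 1"] by force
  next
    assume "has_gaps (\<lambda>i. 1) l \<and> (\<forall>i\<in>X. int (part l i) - int (part l (i + 1)) \<ge> 2)"
    then show "has_gaps (\<lambda>i. 1 + of_bool (i \<in> X)) l"
      by (force simp: has_gaps_def)
  qed
  then show ?thesis
    using distinct_partition_iff_has_gaps[of l]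
    by (simp add: A_set_def partition_of_def) blast
qed

text \<open>The integer differences of sizes and of lengths become sums of naturals, which compose
  directly with \<open>sum_list_raise\<close>.\<close>

lemma A_minus1_set_iff:
  "(\<pi>, \<nu>) \<in> A_minus1_set n k \<longleftrightarrow> has_gaps (\<lambda>i. 2) \<pi> \<and> is_partition \<nu> \<and> distinct \<nu> \<and>
     sum_list \<pi> = n + sum_list \<nu> \<and> length \<pi> = k + length \<nu> \<and>
     positions \<nu> \<subseteq> {..<length \<pi>}"
proof -
  have "is_partition \<pi>" if "has_gaps (\<lambda>i. 2) \<pi>"
    using has_gaps_mono[OF that, of "\<lambda>i. 1"] distinct_partition_iff_has_gaps by auto
  then show ?thesis
    using has_gaps_const_iff[of 2 \<pi>] positions_subset_iff[of \<nu> "length \<pi>"]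
    by (simp add: A_minus1_set_def signed_partition_of_def diff_eq_eq flip: of_nat_add) blast
qed

section \<open>The two bijections\<close>

lemma bij_betw_V_A:
  "bij_betw (\<lambda>(\<alpha>, \<beta>). (raise \<alpha> (positions \<beta>), positions \<beta>)) (V_set n k) (A_set n k)"
  (is "bij_betw ?f _ _")
proof (rule bij_betw_imageI)
  show "inj_on ?f (V_set n k)"
    \<comment> \<open>The second component determines \<beta>; then both first components are raised
      at the same set, so \<alpha> is determined too.\<close>
    by (rule inj_onI) (clarsimp simp: V_set_iff, metis parts_list_positions raise_inject)
  show "?f ` V_set n k = A_set n k"
  proof (intro equalityI subsetI)
    fix p assume "p \<in> ?f ` V_set n k"
    then obtain \<alpha> \<beta> where V: "(\<alpha>, \<beta>) \<in> V_set n k"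
      and p: "p = (raise \<alpha> (positions \<beta>), positions \<beta>)"
      by auto
    have "parts_list (positions \<beta>) = \<beta>" using V by (simp add: V_set_iff parts_list_positions)
    then have "card (positions \<beta>) = length \<beta>" "sum Suc (positions \<beta>) = sum_list \<beta>"
      using parts_list_props(4,5)[of "positions \<beta>"] by simp_all
    then show "p \<in> A_set n k"
      using V has_gaps_raise_iff[of "positions \<beta>" \<alpha> "\<lambda>i. 1"]
      by (simp add: p V_set_iff A_set_iff sum_list_raise)
  next
    fix p assume "p \<in> A_set n k"
    then obtain l X where p: "p = (l, X)" and A: "(l, X) \<in> A_set n k" by (cases p) auto
    then have X: "X \<subseteq> {..<length l}" "finite X"
      using finite_subset by (auto simp: A_set_iff)
    \<comment> \<open>Lowering takes one unit from each labelled gap, which leaves a gap of at least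
      1 there.\<close>
    obtain \<alpha> where \<alpha>: "length \<alpha> = length l" "raise \<alpha> X = l" "has_gaps (\<lambda>i. 1) \<alpha>"
      using raise_surj[OF X(1), of "\<lambda>i. 1"] A by (auto simp: A_set_iff)
    have "(\<alpha>, parts_list X) \<in> V_set n k"
      using A \<alpha> X sum_list_raise[of X \<alpha>] by (simp add: V_set_iff A_set_iff parts_list_props)
    then show "p \<in> ?f ` V_set n k"
      using \<alpha> X p by (force simp: parts_list_props)
  qed
qed

text \<open>Raising at the complement \<open>Y\<close> of the labels adds the size of \<nu>, so the
  signed size stays \<open>n\<close>; the number of positive parts minus \<open>card Y\<close> is
  the number of labels.\<close>

lemma bij_betw_A_minus1_A:
  "bij_betw (\<lambda>(l, X). let Y = {..<length l} - X in (raise l Y, parts_list Y))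
     (A_set n k) (A_minus1_set n k)"
  (is "bij_betw ?f _ _")
proof (rule bij_betw_imageI)
  show "inj_on ?f (A_set n k)"
  proof (rule inj_onI)
    fix p q assume pq: "p \<in> A_set n k" "q \<in> A_set n k" and eq: "?f p = ?f q"
    obtain l X l' X' where p: "p = (l, X)" and q: "q = (l', X')"
      by (cases p, cases q)
    let ?Y = "{..<length l} - X" and ?Y' = "{..<length l'} - X'"
    have eqs: "raise l ?Y = raise l' ?Y'" "parts_list ?Y = parts_list ?Y'"
      using eq by (auto simp: p q Let_def)
    \<comment> \<open>The sets must agree first, because \<open>raise_inject\<close> compares lists
      raised at one common set. With equal lengths, the label sets are then recovered as
      complements.\<close>
    have "?Y = ?Y'"
      using arg_cong[OF eqs(2), of positions] by (simp add: parts_list_props(6))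
    moreover from this have "l = l'" using eqs(1) by (metis raise_inject)
    ultimately show "p = q" using pq by (auto simp: p q A_set_iff)
  qed
  show "?f ` A_set n k = A_minus1_set n k"
  proof (intro equalityI subsetI)
    fix p assume "p \<in> ?f ` A_set n k"
    then obtain l X where A: "(l, X) \<in> A_set n k" and p: "p = ?f (l, X)"
      by auto
    define Y where "Y = {..<length l} - X"
    have Y: "Y \<subseteq> {..<length l}" "finite Y" by (auto simp: Y_def)
    have p: "p = (raise l Y, parts_list Y)" by (simp add: p Y_def Let_def)
    have "has_gaps (\<lambda>i. 1 + of_bool (i \<in> X) + of_bool (i \<in> Y)) (raise l Y)"
      using A Y by (simp only: has_gaps_raise_iff A_set_iff)
    \<comment> \<open>Each position of the list lies in \<open>X\<close> or in \<open>Y\<close>, so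
      one of the two indicators is 1.\<close>
    then have "has_gaps (\<lambda>i. 2) (raise l Y)"
      by (rule has_gaps_mono) (simp add: Y_def)
    moreover have "length l = k + card Y"
      using A card_Diff_subset[of X "{..<length l}"] card_mono[of "{..<length l}" X]
        finite_subset[of X "{..<length l}"]
      by (auto simp: A_set_iff Y_def)
    ultimately show "p \<in> A_minus1_set n k"
      using A Y by (simp add: p A_minus1_set_iff A_set_iff sum_list_raise parts_list_props)
  next
    fix p assume "p \<in> A_minus1_set n k"
    then obtain \<pi> \<nu> where p: "p = (\<pi>, \<nu>)" and A: "(\<pi>, \<nu>) \<in> A_minus1_set n k"
      by (cases p) auto
    define Y where "Y = positions \<nu>"
    define X where "X = {..<length \<pi>} - Y"
    have Y: "Y \<subseteq> {..<length \<pi>}" "finite Y" "parts_list Y = \<nu>"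
      using A by (auto simp: A_minus1_set_iff Y_def parts_list_positions)
    \<comment> \<open>As \<open>X\<close> and \<open>Y\<close> are disjoint, this bound never
      exceeds 2. Lowering at \<open>Y\<close> then leaves the bound that defines a labelled
      partition with label set \<open>X\<close>.\<close>
    have "has_gaps (\<lambda>i. 1 + of_bool (i \<in> X) + of_bool (i \<in> Y)) \<pi>"
      using A has_gaps_mono[of "\<lambda>i. 2" \<pi> "\<lambda>i. 1 + of_bool (i \<in> X) + of_bool (i \<in> Y)"]
      by (simp add: A_minus1_set_iff X_def)
    then obtain l where l: "length l = length \<pi>" "raise l Y = \<pi>"
        "has_gaps (\<lambda>i. 1 + of_bool (i \<in> X)) l"
      by (rule raise_surj[OF Y(1)])
    \<comment> \<open>Since \<open>card Y\<close> is the length of \<nu>, this difference is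
      \<open>k\<close>.\<close>
    have "card X = length \<pi> - card Y"
      using Y by (simp add: X_def card_Diff_subset)
    then have "(l, X) \<in> A_set n k"
      using A l Y sum_list_raise[of Y l] parts_list_props(4,5)[of Y]
      by (auto simp: A_minus1_set_iff A_set_iff X_def)
    moreover have "{..<length l} - X = Y" using Y l by (auto simp: X_def)
    ultimately show "p \<in> ?f ` A_set n k"
      using l Y p by (force simp: Let_def)
  qed
qed

theorem theorem1p4:
  fixes n k :: nat
  shows "V_count n k = A_count n k \<and> A_count n k = A_minus1_count n k"
  unfolding V_count_def A_count_def A_minus1_count_def
  using bij_betw_V_A bij_betw_A_minus1_A by (blast intro: bij_betw_same_card)

end
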